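(* Start from the infinite chain $\mathbb{Z}$ in which every cell has weight $1$, and let $\rho_i=\rho_i(N)$ denote the density of the cells with weight $i$ after $N$ compression steps. Then, for every integer $i\ge1$: in the exponential ordered stochastic compression model, $$\frac{\rho_i}{\rho_1}=i\qquad\text{whenever } N>\log_2 i;$$ in the exponential disordered stochastic compression model, $$\frac{\rho_i}{\rho_1}\to\varphi_i\qquad\text{as } N\to\infty,$$ where the numbers $\varphi_i$ are defined recursively by $$\varphi_1=1,\qquad \varphi_{i+1}=\frac{4}{1-4^{-i}}\sum_{k=0}^{i-1}4^{k-i}\binom{2(i-k)}{k+1}\varphi_{i-k},\quad i\ge1,$$ with $\binom ab=0$ if $b>a$.
   Context: State of the chain: a family $(x_j)_{j\in\mathbb{Z}}$ of nonnegative integer weights. The density of cells with weight $i$ is $$\rho_i=\lim_{L\to\infty}\frac1{2L}\#\{j\in\{-L,\dots,L-1\}:\ x_j=i\}$$ (an almost sure limit, since the states are random). One merging step: every even cell $2j$ independently, with probability $1/2$ each, moves left or right (independently of the current state and of the past), and its weight is added to the weight of the odd cell $2j-1$ or $2j+1$ respectively. Thus the odd cell $2j+1$ receives the new weight $$y_j=x_{2j+1}+\mathbf 1[\text{cell }2j\text{ moves right}]\,x_{2j}+\mathbf 1[\text{cell }2j+2\text{ moves left}]\,x_{2j+2}.$$ Even cells are then empty and the odd cells fill the empty places, compressing the chain twice. Ordered stochastic compression (OSC): the odd cells are only shifted, preserving order, so the new state is $(y_j)_{j\in\mathbb{Z}}$. Disordered stochastic compression (DSC): the odd cells fill the empty places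 in random order (random permutations). This is understood in the sense that after each step the weights of the cells in the chain are independent and identically distributed, the common law being the law of a single merged cell $y_j$; that is, after each DSC step the new state is an i.i.d. family with the one-cell distribution of $y_0$, and the next merging step is applied to this i.i.d. family. "Exponential" refers to repeating the step. *)

theory Defs
  imports "HOL-Probability.Probability"
begin

text \<open>
  A state of the chain is a function \<open>x :: int \<Rightarrow> nat\<close> (cell to weight). A random state is
  represented by its law, a probability measure on the product space \<open>chain_space\<close>.
\<close>

definition chain_space :: "(int \<Rightarrow> nat) measure" where
  "chain_space = Pi\<^sub>M UNIV (\<lambda>_. count_space UNIV)"

text \<open>\<open>has_cell_density \<nu> i r\<close>: if the state has law \<open>\<nu>\<close>, then the density of the cells of
  weight \<open>i\<close> exists almost surely and equals the constant \<open>r\<close>.\<close>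

definition has_cell_density :: "(int \<Rightarrow> nat) measure \<Rightarrow> nat \<Rightarrow> real \<Rightarrow> bool" where
  "has_cell_density \<nu> i r \<longleftrightarrow>
     (AE x in \<nu>. (\<lambda>L::nat. real (card {j \<in> {- int L..<int L}. x j = i}) / (2 * real L))
                   \<longlonglongrightarrow> r)"

definition cell_density :: "(int \<Rightarrow> nat) measure \<Rightarrow> nat \<Rightarrow> real" where
  "cell_density \<nu> i = (THE r. has_cell_density \<nu> i r)"

text \<open>\<open>c j\<close> says whether the even cell \<open>2 * j\<close> moves right (otherwise it moves left).\<close>

definition merge_cells :: "(int \<Rightarrow> nat) \<Rightarrow> (int \<Rightarrow> bool) \<Rightarrow> int \<Rightarrow> nat" where
  "merge_cells x c j =
     x (2 * j + 1) + (if c j then x (2 * j) else 0) + (if c (j + 1) then 0 else x (2 * j + 2))"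

definition fair_moves :: "(int \<Rightarrow> bool) measure" where
  "fair_moves = Pi\<^sub>M UNIV (\<lambda>_. measure_pmf (bernoulli_pmf (1 / 2)))"

text \<open>Law of the family of merged odd cells. The product measure expresses that the moves of the
  even cells are independent of the current state; since each step draws fresh moves, they are
  independent of the past as well.\<close>

definition merge_law :: "(int \<Rightarrow> nat) measure \<Rightarrow> (int \<Rightarrow> nat) measure" where
  "merge_law \<nu> = distr (\<nu> \<Otimes>\<^sub>M fair_moves) chain_space (\<lambda>(x, c). merge_cells x c)"

definition unit_chain :: "(int \<Rightarrow> nat) measure" where
  "unit_chain = return chain_space (\<lambda>_. 1)"

definition osc_step :: "(int \<Rightarrow> nat) measure \<Rightarrow> (int \<Rightarrow> nat) measure" where
  "osc_step \<nu> = merge_law \<nu>"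

definition dsc_step :: "(int \<Rightarrow> nat) measure \<Rightarrow> (int \<Rightarrow> nat) measure" where
  "dsc_step \<nu> = Pi\<^sub>M UNIV (\<lambda>_. distr (merge_law \<nu>) (count_space UNIV) (\<lambda>y. y 0))"

definition osc :: "nat \<Rightarrow> (int \<Rightarrow> nat) measure" where
  "osc N = (osc_step ^^ N) unit_chain"

definition dsc :: "nat \<Rightarrow> (int \<Rightarrow> nat) measure" where
  "dsc N = (dsc_step ^^ N) unit_chain"

text \<open>The value \<open>phi 0\<close> is a dummy: the sum only involves \<open>phi m\<close> with \<open>1 \<le> m \<le> i\<close>.\<close>

fun phi :: "nat \<Rightarrow> real" where
  "phi 0 = 0"
| "phi (Suc i) =
     (if i = 0 then 1
      else 4 / (1 - 4 powi (- int i)) *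
           (\<Sum>k = 0..i - 1. 4 powi (int k - int i) * real ((2 * (i - k)) choose (k + 1)) * phi (i - k)))"

text \<open>The laws above are probability measures on \<open>chain_space\<close>, and densities are unique.\<close>

lemma prob_space_fair_moves: "prob_space fair_moves"
  unfolding fair_moves_def by (intro prob_space_PiM prob_space_measure_pmf)

lemma merge_cells_measurable:
  assumes "sets \<nu> = sets chain_space"
  shows "(\<lambda>(x, c). merge_cells x c) \<in> measurable (\<nu> \<Otimes>\<^sub>M fair_moves) chain_space"
proof -
  have s: "sets (\<nu> \<Otimes>\<^sub>M fair_moves) =
      sets (chain_space \<Otimes>\<^sub>M (Pi\<^sub>M UNIV (\<lambda>_::int. count_space (UNIV :: bool set))))"
    unfolding fair_moves_def by (intro sets_pair_measure_cong assms sets_PiM_cong) auto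
  show ?thesis
    unfolding measurable_cong_sets[OF s refl] chain_space_def
  proof (rule measurable_PiM_single')
    fix j :: int
    have x [measurable]: "(\<lambda>p. fst p k) \<in> measurable (Pi\<^sub>M UNIV (\<lambda>_::int. count_space (UNIV :: nat set))
        \<Otimes>\<^sub>M Pi\<^sub>M UNIV (\<lambda>_::int. count_space (UNIV :: bool set))) (count_space UNIV)" for k
      by (rule measurable_compose[OF measurable_fst measurable_component_singleton]) simp
    have c [measurable]: "(\<lambda>p. snd p k) \<in> measurable (Pi\<^sub>M UNIV (\<lambda>_::int. count_space (UNIV :: nat set))
        \<Otimes>\<^sub>M Pi\<^sub>M UNIV (\<lambda>_::int. count_space (UNIV :: bool set))) (count_space UNIV)" for k
      by (rule measurable_compose[OF measurable_snd measurable_component_singleton]) simp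
    show "(\<lambda>p. (case p of (x, c) \<Rightarrow> merge_cells x c) j) \<in> measurable (Pi\<^sub>M UNIV (\<lambda>_::int. count_space (UNIV :: nat set))
        \<Otimes>\<^sub>M Pi\<^sub>M UNIV (\<lambda>_::int. count_space (UNIV :: bool set))) (count_space UNIV)"
      unfolding merge_cells_def case_prod_beta by measurable
  qed auto
qed

lemma merge_law_prob:
  assumes "prob_space \<nu>" "sets \<nu> = sets chain_space"
  shows "prob_space (merge_law \<nu>)" "sets (merge_law \<nu>) = sets chain_space"
proof -
  interpret pair_prob_space \<nu> fair_moves
    using assms prob_space_fair_moves
    by (simp add: pair_prob_space_def pair_sigma_finite_def prob_space_imp_sigma_finite)
  show "prob_space (merge_law \<nu>)"
    unfolding merge_law_def by (intro P.prob_space_distr merge_cells_measurable assms)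
  show "sets (merge_law \<nu>) = sets chain_space"
    by (simp add: merge_law_def)
qed

lemma dsc_step_prob:
  assumes "prob_space \<nu>" "sets \<nu> = sets chain_space"
  shows "prob_space (dsc_step \<nu>)" "sets (dsc_step \<nu>) = sets chain_space"
proof -
  have "(\<lambda>y. y 0) \<in> measurable (merge_law \<nu>) (count_space UNIV)"
    unfolding measurable_cong_sets[OF merge_law_prob(2)[OF assms] refl] chain_space_def
    by measurable
  then show "prob_space (dsc_step \<nu>)"
    unfolding dsc_step_def
    by (intro prob_space_PiM prob_space.prob_space_distr merge_law_prob assms)
  show "sets (dsc_step \<nu>) = sets chain_space"
    unfolding dsc_step_def chain_space_def by (intro sets_PiM_cong) auto
qed

lemma unit_chain_prob: "prob_space unit_chain" "sets unit_chain = sets chain_space"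
  unfolding unit_chain_def
  by (auto intro!: prob_space_return simp: chain_space_def space_PiM)

lemma osc_prob: "prob_space (osc N)" "sets (osc N) = sets chain_space"
proof -
  have "prob_space (osc N) \<and> sets (osc N) = sets chain_space"
    by (induction N) (auto simp: osc_def osc_step_def unit_chain_prob merge_law_prob)
  then show "prob_space (osc N)" "sets (osc N) = sets chain_space" by auto
qed

lemma dsc_prob: "prob_space (dsc N)" "sets (dsc N) = sets chain_space"
proof -
  have "prob_space (dsc N) \<and> sets (dsc N) = sets chain_space"
    by (induction N) (auto simp: dsc_def unit_chain_prob dsc_step_prob)
  then show "prob_space (dsc N)" "sets (dsc N) = sets chain_space" by auto
qed

lemma cell_density_eq:
  assumes "prob_space \<nu>" "has_cell_density \<nu> i r"
  shows "cell_density \<nu> i = r"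
  unfolding cell_density_def
proof (rule the_equality)
  interpret prob_space \<nu> by fact
  fix r' assume "has_cell_density \<nu> i r'"
  with assms(2) have "AE x in \<nu>. r' = r"
    unfolding has_cell_density_def by eventually_elim (rule LIMSEQ_unique)
  then show "r' = r" by simp
qed (fact assms(2))

end

theory Submission
  imports Defs "HOL-Probability.Hoeffding" "HOL-Computational_Algebra.Formal_Power_Series"
begin

text \<open>
  Ordered model: after \<open>N\<close> steps the boundary between cells \<open>j - 1\<close> and \<open>j\<close> sits at \<open>2 ^ N * j + u j\<close>,
  where the \<open>u j\<close> are independent and uniform on \<open>{0..<2 ^ N}\<close>, because a step selects the old
  boundary \<open>2 * j\<close> or \<open>2 * j + 1\<close> by a fair coin. A weight is a difference of neighbouring boundaries,
  hence has value \<open>i \<le> 2 ^ N\<close> with probability \<open>i / 4 ^ N\<close>.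

  Disordered model: the generating function of the one-cell law is the \<open>N\<close>-fold iterate \<open>F N\<close> of
  \<open>f = z * (1 + z)\<^sup>2 / 4\<close>. Writing \<open>F (Suc N)\<close> as \<open>F N\<close> composed with \<open>f\<close>, the scaled coefficients
  \<open>4 ^ N * [z^n] F N\<close> satisfy affine recursions with contraction factor \<open>4 ^ (1 - n)\<close>; their limits
  solve Koenigs' equation \<open>\<Phi> (f z) = \<Phi> z / 4\<close>, whose coefficientwise form is the recursion for \<open>phi\<close>.

  Densities are almost sure limits by Hoeffding's inequality and the Borel--Cantelli lemma.
\<close>

unbundle no vec_syntax
unbundle fps_syntax

subsection \<open>Almost sure densities\<close>

text \<open>Hoeffding's bound sees \<open>S n\<close> only through its size and is summable in
  \<open>n\<close> for each fixed tolerance, so Borel--Cantelli applies to any choice of windows,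
  nested or not.\<close>

lemma (in prob_space) indep_bounded_average_tendsto:
  fixes Z :: "'b \<Rightarrow> 'a \<Rightarrow> real"
  assumes indep: "indep_vars (\<lambda>_. borel) Z I"
    and range: "\<And>j x. j \<in> I \<Longrightarrow> Z j x \<in> {0..1}"
    and mean: "\<And>j. j \<in> I \<Longrightarrow> expectation (Z j) = p"
    and S: "\<And>n. S n \<subseteq> I" "\<And>n. finite (S n)" "\<And>n. card (S n) = n"
  shows "AE x in M. (\<lambda>n. (\<Sum>j\<in>S n. Z j x) / real n) \<longlonglongrightarrow> p"
proof -
  have Zm: "random_variable borel (Z j)" if "j \<in> I" for j
    using indep that unfolding indep_vars_def by blast
  then have [measurable]: "Z j \<in> borel_measurable M" if "j \<in> S n" for j n
    using S(1) that by blast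
  \<comment> \<open>Tolerances of the form \<open>1 / Suc k\<close> are cofinal and countable, so
    the exceptional null sets can be united over \<open>k\<close>.\<close>
  define A where "A k n = {x \<in> space M. \<bar>(\<Sum>j\<in>S n. Z j x) - n * p\<bar> \<ge> n / real (Suc k)}" for k n
  have Am: "A k n \<in> sets M" for k n
    unfolding A_def by measurable
  \<comment> \<open>A power of a fixed base below 1 yields a geometric series. At
    \<open>n = 0\<close>, where the denominator in Hoeffding's exponent would vanish, the bound is
    the trivial \<open>2\<close>.\<close>
  have le: "prob (A k n) \<le> 2 * exp (-2 / real (Suc k) ^ 2) ^ n" for k n
  proof (cases "n = 0")
    case True
    then show ?thesis using prob_le_1[of "A k n"] by (simp del: prob_le_1)
  next
    case False
    interpret Hoeffding_ineq M "S n" Z "\<lambda>_. 0" "\<lambda>_. 1" "\<Sum>j\<in>S n. expectation (Z j)"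
    proof unfold_locales
      show "indep_vars (\<lambda>_. borel) Z (S n)" by (rule indep_vars_subset[OF indep S(1)])
      show "AE x in M. Z j x \<in> {0..1}" if "j \<in> S n" for j
        using range S(1) that by (intro AE_I2) blast
    qed (rule S)
    have mu: "(\<Sum>j\<in>S n. expectation (Z j)) = n * p"
    proof -
      have "(\<Sum>j\<in>S n. expectation (Z j)) = (\<Sum>j\<in>S n. p)"
        using S(1) by (intro sum.cong mean) auto
      then show ?thesis by (simp add: S)
    qed
    have "prob (A k n) \<le> 2 * exp (-2 * (n / real (Suc k))\<^sup>2 / (\<Sum>i\<in>S n. (1 - 0)\<^sup>2))"
      unfolding A_def mu[symmetric] using False S
      by (intro Hoeffding_ineq_abs_ge) (auto intro!: divide_nonneg_nonneg)
    also have "-2 * (n / real (Suc k))\<^sup>2 / (\<Sum>i\<in>S n. (1 - 0)\<^sup>2) = n * (-2 / real (Suc k) ^ 2)"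
      using False S by (simp add: power2_eq_square)
    finally show ?thesis by (simp only: exp_of_nat_mult)
  qed
  have "AE x in M. \<forall>\<^sub>F n in sequentially. x \<in> space M - A k n" for k
  proof (rule borel_cantelli_AE1)
    have "summable (\<lambda>n. 2 * exp (-2 / real (Suc k) ^ 2) ^ n)"
      by (intro summable_mult summable_geometric) (auto simp: field_simps)
    then show "summable (\<lambda>n. prob (A k n))"
      by (rule summable_comparison_test'[where N = 0]) (use le in auto)
  qed (auto simp: Am less_top[symmetric])
  then have "AE x in M. \<forall>k. \<forall>\<^sub>F n in sequentially. x \<in> space M - A k n"
    by (simp add: AE_all_countable)
  then show ?thesis
  proof eventually_elim
    case (elim x)
    show ?case
    proof (rule LIMSEQ_I)
      fix e :: real assume "e > 0"
      then obtain k where k: "1 / real (Suc k) < e"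
        using nat_approx_posE by (metis of_nat_Suc)
      from elim have "\<forall>\<^sub>F n in sequentially. x \<in> space M - A k n" by blast
      then obtain n0 where n0: "\<And>n. n \<ge> n0 \<Longrightarrow> x \<in> space M - A k n"
        by (auto simp: eventually_sequentially)
      show "\<exists>n0. \<forall>n\<ge>n0. norm ((\<Sum>j\<in>S n. Z j x) / real n - p) < e"
      proof (intro exI allI impI)
        fix n assume n: "n \<ge> max 1 n0"
        then have "\<bar>(\<Sum>j\<in>S n. Z j x) - n * p\<bar> < n / real (Suc k)"
          using n0[of n] by (auto simp: A_def)
        then have "\<bar>(\<Sum>j\<in>S n. Z j x) - n * p\<bar> / n < 1 / real (Suc k)"
          using n by (simp add: field_simps)
        also have "\<bar>(\<Sum>j\<in>S n. Z j x) - n * p\<bar> / n = \<bar>(\<Sum>j\<in>S n. Z j x) / n - p\<bar>"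
        proof -
          have "(\<Sum>j\<in>S n. Z j x) / n - p = ((\<Sum>j\<in>S n. Z j x) - n * p) / n"
            using n by (simp add: field_simps)
          then show ?thesis by simp
        qed
        finally show "norm ((\<Sum>j\<in>S n. Z j x) / real n - p) < e"
          using k by simp
      qed
    qed
  qed
qed

lemma card_window_parity:
  "card {j \<in> {- int L..<int L}. even j} = L" "card {j \<in> {- int L..<int L}. odd j} = L"
proof -
  let ?E = "{j \<in> {- int L..<int L}. even j}" and ?O = "{j \<in> {- int L..<int L}. odd j}"
  have fin: "finite ?E" "finite ?O"
    by (rule finite_subset[of _ "{- int L..<int L}"]; auto)+
  \<comment> \<open>Reflection about \<open>-1/2\<close> preserves the half-open window and flips
    parity.\<close>
  have "bij_betw (\<lambda>j. - 1 - j) ?E ?O"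
    by (rule bij_betw_byWitness[of _ "\<lambda>j. - 1 - j"]) auto
  then have eq: "card ?E = card ?O" by (rule bij_betw_same_card)
  have "card ?E + card ?O = card (?E \<union> ?O)"
    using fin by (intro card_Un_disjoint[symmetric]) blast+
  also have "?E \<union> ?O = {- int L..<int L}" by blast
  finally have "card ?E + card ?O = 2 * L" by simp
  with eq show "card ?E = L" "card ?O = L" by linarith+
qed


text \<open>Independence is only required within each parity class: in the ordered model adjacent cells
  share a boundary, so the weights are merely 1-dependent.\<close>

lemma (in prob_space) AE_density_tendsto:
  fixes X :: "int \<Rightarrow> 'a \<Rightarrow> 'b"
  assumes indep: "indep_vars (\<lambda>_. count_space UNIV) X {j. even j}"
      "indep_vars (\<lambda>_. count_space UNIV) X {j. odd j}"
    and p: "\<And>j. prob {x \<in> space M. X j x = i} = p"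
  shows "AE x in M. (\<lambda>L. real (card {j \<in> {- int L..<int L}. X j x = i}) / (2 * real L)) \<longlonglongrightarrow> p"
proof -
  define Z :: "int \<Rightarrow> 'a \<Rightarrow> real" where "Z j x = of_bool (X j x = i)" for j x
  \<comment> \<open>The boolean \<open>e\<close> selects the parity class. Each class fills exactly
    half of the window, so the density is the mean of the two class averages.\<close>
  have *: "AE x in M. (\<lambda>L. (\<Sum>j | j \<in> {- int L..<int L} \<and> (even j \<longleftrightarrow> e). Z j x) / real L) \<longlonglongrightarrow> p" for e
  proof (rule indep_bounded_average_tendsto[where I = "{j. even j \<longleftrightarrow> e}"])
    have ind: "indep_vars (\<lambda>_. count_space UNIV) X {j. even j \<longleftrightarrow> e}"
      using indep by (cases e) auto
    then show "indep_vars (\<lambda>_. borel) Z {j. even j \<longleftrightarrow> e}"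
      unfolding Z_def by (rule indep_vars_compose2) auto
    show "expectation (Z j) = p" if "j \<in> {j. even j \<longleftrightarrow> e}" for j
    proof -
      have "X j \<in> measurable M (count_space UNIV)"
        using ind that by (auto simp: indep_vars_def)
      then have m: "{x \<in> space M. X j x = i} \<in> sets M" by measurable
      have "expectation (Z j) = expectation (indicator {x \<in> space M. X j x = i})"
        by (intro Bochner_Integration.integral_cong) (auto simp: Z_def)
      with m p show ?thesis by simp
    qed
    show "card {j. j \<in> {- int L..<int L} \<and> (even j \<longleftrightarrow> e)} = L" for L
      using card_window_parity[of L] by (cases e) auto
    show "finite {j. j \<in> {- int L..<int L} \<and> (even j \<longleftrightarrow> e)}" for L
      by (rule finite_subset[of _ "{- int L..<int L}"]) auto
  qed (auto simp: Z_def)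
  from *[of True] *[of False] show ?thesis
  proof eventually_elim
    case (elim x)
    have "real (card {j \<in> {- int L..<int L}. X j x = i}) / (2 * real L) =
        ((\<Sum>j | j \<in> {- int L..<int L} \<and> (even j \<longleftrightarrow> True). Z j x) / real L +
         (\<Sum>j | j \<in> {- int L..<int L} \<and> (even j \<longleftrightarrow> False). Z j x) / real L) / 2" for L
    proof -
      have "real (card {j \<in> {- int L..<int L}. X j x = i}) = (\<Sum>j\<in>{- int L..<int L}. Z j x)"
        unfolding Z_def by (subst sum_of_bool_eq) (auto simp: Int_def)
      also have "\<dots> = (\<Sum>j\<in>{j. j \<in> {- int L..<int L} \<and> (even j \<longleftrightarrow> True)} \<union>
          {j. j \<in> {- int L..<int L} \<and> (even j \<longleftrightarrow> False)}. Z j x)"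
        by (rule sum.cong) auto
      also have "\<dots> = (\<Sum>j | j \<in> {- int L..<int L} \<and> (even j \<longleftrightarrow> True). Z j x) +
          (\<Sum>j | j \<in> {- int L..<int L} \<and> (even j \<longleftrightarrow> False). Z j x)"
        proof (rule sum.union_disjoint)
          have "finite {j. j \<in> {- int L..<int L} \<and> (even j \<longleftrightarrow> b)}" for b
            by (rule finite_subset[of _ "{- int L..<int L}"]) auto
          then show "finite {j. j \<in> {- int L..<int L} \<and> (even j \<longleftrightarrow> True)}"
            "finite {j. j \<in> {- int L..<int L} \<and> (even j \<longleftrightarrow> False)}" by blast+
        qed auto
      finally show ?thesis by (simp only: add_divide_distrib [symmetric] divide_divide_eq_left mult.commute)
    qed
    moreover have "(\<lambda>L. ((\<Sum>j | j \<in> {- int L..<int L} \<and> (even j \<longleftrightarrow> True). Z j x) / real L +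
         (\<Sum>j | j \<in> {- int L..<int L} \<and> (even j \<longleftrightarrow> False). Z j x) / real L) / 2) \<longlonglongrightarrow> (p + p) / 2"
      using elim by (intro tendsto_intros) auto
    ultimately show ?case by (simp only: field_sum_of_halves add_divide_distrib)
  qed
qed

lemma indep_vars_PiM_coordinates:
  assumes "\<And>i. i \<in> I \<Longrightarrow> prob_space (M i)" "I \<noteq> {}"
  shows "prob_space.indep_vars (PiM I M) M (\<lambda>i x. x i) I"
proof -
  interpret prob_space "PiM I M" using assms by (intro prob_space_PiM)
  have "distr (PiM I M) (PiM I M) (\<lambda>x. \<lambda>i\<in>I. x i) = distr (PiM I M) (PiM I M) (\<lambda>x. x)"
    by (intro distr_cong) (auto simp: space_PiM PiE_iff extensional_restrict)
  also have "\<dots> = PiM I (\<lambda>i. distr (PiM I M) (M i) (\<lambda>x. x i))"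
    unfolding distr_id using assms by (intro PiM_cong refl) (simp add: distr_PiM_component)
  finally show ?thesis
    using assms by (subst indep_vars_iff_distr_eq_PiM') auto
qed

subsection \<open>Independent identically distributed chains\<close>

text \<open>With a pmf as one-cell law, the moves, the boundary offsets and the disordered chains
  are all instances of one product measure.\<close>

definition iid_chain :: "'a pmf \<Rightarrow> (int \<Rightarrow> 'a) measure" where
  "iid_chain p = Pi\<^sub>M UNIV (\<lambda>_. measure_pmf p)"

lemma fair_moves_eq: "fair_moves = iid_chain (bernoulli_pmf (1/2))"
  by (simp add: fair_moves_def iid_chain_def)

lemma prob_space_iid_chain: "prob_space (iid_chain p)"
  unfolding iid_chain_def by (intro prob_space_PiM prob_space_measure_pmf)

lemma space_iid_chain [simp]: "space (iid_chain p) = UNIV"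
  by (simp add: iid_chain_def space_PiM)

lemma sets_iid_chain: "sets (iid_chain p) = sets (Pi\<^sub>M UNIV (\<lambda>_. count_space UNIV))"
  unfolding iid_chain_def by (intro sets_PiM_cong) auto

lemma sets_iid_chain_nat: "sets (iid_chain (q :: nat pmf)) = sets chain_space"
  by (simp add: sets_iid_chain chain_space_def)

lemma prod_emb_PiE_UNIV:
  "prod_emb UNIV (\<lambda>_. count_space UNIV) J (Pi\<^sub>E J A) = {x. \<forall>j\<in>J. x j \<in> A j}"
  by (auto simp: prod_emb_def)

lemma sets_PiM_cylinder:
  "finite J \<Longrightarrow> {x. \<forall>j\<in>J. x j \<in> A j} \<in> sets (Pi\<^sub>M UNIV (\<lambda>_. count_space UNIV))"
  using sets_PiM_I[of J UNIV A "\<lambda>_. count_space UNIV"] by (simp add: prod_emb_PiE_UNIV)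

lemma sets_iid_chain_cylinder: "finite J \<Longrightarrow> {x. \<forall>j\<in>J. x j \<in> A j} \<in> sets (iid_chain p)"
  unfolding sets_iid_chain by (rule sets_PiM_cylinder)

lemma emeasure_iid_chain:
  assumes "finite J"
  shows "emeasure (iid_chain p) {x. \<forall>j\<in>J. x j \<in> A j} = (\<Prod>j\<in>J. emeasure (measure_pmf p) (A j))"
proof -
  interpret product_prob_space "\<lambda>_. measure_pmf p" "UNIV :: int set" ..
  show ?thesis
    using emeasure_PiM_Collect[of J A] assms by (simp add: iid_chain_def space_PiM)
qed

text \<open>Finite cylinders are an intersection-stable generator, so their values determine the
  law.\<close>

lemma iid_chain_eqI:
  fixes M :: "(int \<Rightarrow> 'a) measure"
  assumes "sets M = sets (Pi\<^sub>M UNIV (\<lambda>_. count_space UNIV))"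
    and "\<And>J A. finite J \<Longrightarrow>
      emeasure M {x. \<forall>j\<in>J. x j \<in> A j} = (\<Prod>j\<in>J. emeasure (measure_pmf p) (A j))"
  shows "M = iid_chain p"
proof -
  interpret prob_space "iid_chain p" by (rule prob_space_iid_chain)
  have "iid_chain p = M"
    by (rule measure_eqI_PiM_infinite[where I = UNIV and M = "\<lambda>_. count_space UNIV"])
       (auto simp: sets_iid_chain assms prod_emb_PiE_UNIV emeasure_iid_chain finite_measure_axioms)
  then show ?thesis ..
qed

lemma distr_coord_iid_chain:
  "distr (iid_chain p) (count_space UNIV) (\<lambda>x. x j) = measure_pmf p"
proof -
  have "distr (iid_chain p) (count_space UNIV) (\<lambda>x. x j) = distr (iid_chain p) (measure_pmf p) (\<lambda>x. x j)"
    by (intro distr_cong) auto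
  then show ?thesis
    using distr_PiM_component[of UNIV "\<lambda>_. measure_pmf p" j]
    by (simp add: iid_chain_def prob_space_measure_pmf)
qed

lemma indep_vars_iid_chain:
  "prob_space.indep_vars (iid_chain p) (\<lambda>_. count_space UNIV) (\<lambda>j x. x j) UNIV"
proof -
  interpret prob_space "iid_chain p" by (rule prob_space_iid_chain)
  have "indep_vars (\<lambda>_. measure_pmf p) (\<lambda>j x. x j) UNIV"
    unfolding iid_chain_def by (rule indep_vars_PiM_coordinates) (auto intro: prob_space_measure_pmf)
  from indep_vars_compose2[OF this, of "\<lambda>_ y. y" "\<lambda>_. count_space UNIV"] show ?thesis by simp
qed

lemma AE_iid_chain:
  assumes "\<And>y. y \<in> set_pmf p \<Longrightarrow> P y"
  shows "AE x in iid_chain p. \<forall>j. P (x j)"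
proof -
  have "AE x in iid_chain p. P (x j)" for j
    unfolding iid_chain_def
    by (rule AE_PiM_component) (use assms in \<open>auto simp: AE_measure_pmf_iff intro: prob_space_measure_pmf\<close>)
  then show ?thesis by (simp add: AE_all_countable)
qed

text \<open>There are only countably many cells, so almost surely all of them equal \<open>a\<close>
  at once. This makes \<open>unit_chain\<close> an i.i.d. chain, the start of the induction in
  \<open>dsc_eq\<close>.\<close>

lemma iid_chain_return_pmf: "iid_chain (return_pmf a) = return (Pi\<^sub>M UNIV (\<lambda>_. count_space UNIV)) (\<lambda>_. a)"
proof -
  interpret prob_space "iid_chain (return_pmf a)" by (rule prob_space_iid_chain)
  have "AE x in iid_chain (return_pmf a). \<forall>j. x j = a"
    by (rule AE_iid_chain) auto
  then have "AE x in iid_chain (return_pmf a). x = (\<lambda>_. a)"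
    by (simp add: fun_eq_iff)
  then have "iid_chain (return_pmf a) = return (iid_chain (return_pmf a)) (\<lambda>_. a)"
    by (rule AE_eq_constD)
  also have "\<dots> = return (Pi\<^sub>M UNIV (\<lambda>_. count_space UNIV)) (\<lambda>_. a)"
    by (intro return_cong sets_iid_chain)
  finally show ?thesis .
qed

lemma nn_integral_prod_coords_iid_chain:
  assumes "finite J"
  shows "(\<integral>\<^sup>+x. (\<Prod>j\<in>J. h j (x j)) \<partial>iid_chain p) = (\<Prod>j\<in>J. \<integral>\<^sup>+y. h j y \<partial>measure_pmf p)"
proof -
  interpret prob_space "iid_chain p" by (rule prob_space_iid_chain)
  have "indep_vars (\<lambda>_. borel) (\<lambda>j x. h j (x j)) J"
    by (rule indep_vars_compose2[OF indep_vars_subset[OF indep_vars_iid_chain]]) auto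
  then have "(\<integral>\<^sup>+x. (\<Prod>j\<in>J. h j (x j)) \<partial>iid_chain p) = (\<Prod>j\<in>J. \<integral>\<^sup>+x. h j (x j) \<partial>iid_chain p)"
    using assms by (intro indep_vars_nn_integral) auto
  moreover have "(\<integral>\<^sup>+x. h j (x j) \<partial>iid_chain p) = (\<integral>\<^sup>+y. h j y \<partial>measure_pmf p)" for j
    by (subst distr_coord_iid_chain[of p j, symmetric], subst nn_integral_distr)
       (auto simp: measurable_cong_sets[OF sets_iid_chain refl])
  ultimately show ?thesis by simp
qed

lemma measurable_iid_chain_select:
  fixes p :: "'a pmf" and g h :: "'a \<Rightarrow> 'b"
  shows "(\<lambda>(u, c) j. if c j then g (u (2 * j)) else h (u (2 * j + 1))) \<in>
    measurable (iid_chain p \<Otimes>\<^sub>M fair_moves) (Pi\<^sub>M UNIV (\<lambda>_. count_space UNIV))"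
    (is "?f \<in> measurable ?M ?N")
proof (rule measurable_PiM_single')
  fix j :: int
  have u: "(\<lambda>w. fst w k) \<in> measurable ?M (count_space UNIV)" for k
    by (rule measurable_compose[OF measurable_fst])
       (simp add: measurable_cong_sets[OF sets_iid_chain refl])
  have [measurable]: "(\<lambda>w. r (fst w k)) \<in> measurable ?M (count_space UNIV)" for k and r :: "'a \<Rightarrow> 'b"
    by (rule measurable_compose[OF u]) simp
  have c [measurable]: "(\<lambda>w. snd w k) \<in> measurable ?M (count_space UNIV)" for k
    by (rule measurable_compose[OF measurable_snd])
       (simp add: fair_moves_eq measurable_cong_sets[OF sets_iid_chain refl])
  show "(\<lambda>w. (case w of (u, c) \<Rightarrow> \<lambda>j. if c j then g (u (2 * j)) else h (u (2 * j + 1))) j)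
      \<in> measurable ?M (count_space UNIV)"
    unfolding case_prod_beta by measurable
qed (auto simp: space_pair_measure)

text \<open>Given the moves, distinct new cells read distinct old cells, which is why independence
  survives.\<close>

lemma iid_chain_select:
  fixes p :: "'a pmf" and g h :: "'a \<Rightarrow> 'b"
  shows "distr (iid_chain p \<Otimes>\<^sub>M fair_moves) (Pi\<^sub>M UNIV (\<lambda>_. count_space UNIV))
      (\<lambda>(u, c) j. if c j then g (u (2 * j)) else h (u (2 * j + 1))) =
    iid_chain (bernoulli_pmf (1/2) \<bind> (\<lambda>s. map_pmf (if s then g else h) p))"
    (is "distr ?M ?N ?f = iid_chain ?q")
proof (rule iid_chain_eqI)
  interpret P: prob_space "iid_chain p" by (rule prob_space_iid_chain)
  interpret Q: prob_space fair_moves by (rule prob_space_fair_moves)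
  interpret PQ: pair_sigma_finite "iid_chain p" fair_moves ..
  have f: "?f \<in> measurable ?M ?N"
    by (rule measurable_iid_chain_select)
  fix J :: "int set" and A :: "int \<Rightarrow> 'b set" assume J: "finite J"
  define E where "E = {x. \<forall>j\<in>J. x j \<in> A j}"
  define F where "F j s = (if s then g -` A j else h -` A j)" for j s
  have E: "E \<in> sets ?N"
    unfolding E_def by (rule sets_PiM_cylinder[OF J])
  have "emeasure (distr ?M ?N ?f) E = emeasure ?M (?f -` E \<inter> space ?M)"
    by (rule emeasure_distr[OF f E])
  \<comment> \<open>Slicing at fixed moves \<open>c\<close> leaves an event about \<open>u\<close>
    alone, which is a cylinder.\<close>
  also have "\<dots> = (\<integral>\<^sup>+c. emeasure (iid_chain p) ((\<lambda>u. (u, c)) -` (?f -` E \<inter> space ?M)) \<partial>fair_moves)"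
    by (intro PQ.emeasure_pair_measure_alt2 measurable_sets[OF f E])
  also have "\<dots> = (\<integral>\<^sup>+c. (\<Prod>j\<in>J. emeasure (measure_pmf p) (F j (c j))) \<partial>fair_moves)"
  proof (rule nn_integral_cong)
    fix c :: "int \<Rightarrow> bool"
    \<comment> \<open>\<open>t j\<close> is the old cell read by the new cell \<open>j\<close>. It
      is recovered by \<open>div 2\<close>, so distinct new cells never share an old one.\<close>
    define t where "t j = 2 * j + of_bool (\<not> c j)" for j
    have div: "t j div 2 = j" for j by (simp add: t_def)
    then have inj: "inj_on t J" by (metis inj_onI)
    have "(\<lambda>u. (u, c)) -` (?f -` E \<inter> space ?M) =
        {u. \<forall>k\<in>t ` J. u k \<in> F (k div 2) (c (k div 2))}"
      by (auto simp: E_def div F_def space_pair_measure fair_moves_eq) (auto simp: t_def split: if_splits)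
    also have "emeasure (iid_chain p) \<dots> = (\<Prod>k\<in>t ` J. emeasure (measure_pmf p) (F (k div 2) (c (k div 2))))"
      using J by (intro emeasure_iid_chain) auto
    also have "\<dots> = (\<Prod>j\<in>J. emeasure (measure_pmf p) (F j (c j)))"
      by (simp add: prod.reindex[OF inj] div)
    finally show "emeasure (iid_chain p) ((\<lambda>u. (u, c)) -` (?f -` E \<inter> space ?M)) =
      (\<Prod>j\<in>J. emeasure (measure_pmf p) (F j (c j)))" .
  qed
  also have "\<dots> = (\<Prod>j\<in>J. \<integral>\<^sup>+s. emeasure (measure_pmf p) (F j s) \<partial>bernoulli_pmf (1/2))"
    unfolding fair_moves_eq by (rule nn_integral_prod_coords_iid_chain[OF J])
  also have "\<dots> = (\<Prod>j\<in>J. emeasure (measure_pmf ?q) (A j))"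
    by (simp add: F_def)
  finally show "emeasure (distr ?M ?N ?f) {x. \<forall>j\<in>J. x j \<in> A j} = (\<Prod>j\<in>J. emeasure (measure_pmf ?q) (A j))"
    unfolding E_def .
qed simp

subsection \<open>The ordered model\<close>

lemma measurable_Pair_count_space:
  fixes f :: "'a \<Rightarrow> 'b::countable" and g :: "'a \<Rightarrow> 'c::countable"
  assumes "f \<in> measurable M (count_space UNIV)" "g \<in> measurable M (count_space UNIV)"
  shows "(\<lambda>x. (f x, g x)) \<in> measurable M (count_space UNIV)"
  using measurable_Pair[OF assms] by (simp add: pair_measure_countable)

lemma pair_pmf_of_set:
  assumes "finite A" "A \<noteq> {}" "finite B" "B \<noteq> {}"
  shows "pair_pmf (pmf_of_set A) (pmf_of_set B) = pmf_of_set (A \<times> B)"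
proof (rule pmf_eqI)
  fix w :: "'a \<times> 'b"
  show "pmf (pair_pmf (pmf_of_set A) (pmf_of_set B)) w = pmf (pmf_of_set (A \<times> B)) w"
    using assms by (cases w) (simp add: pmf_pair card_cartesian_product indicator_def)
qed

lemma distr_two_coords_iid_chain:
  fixes p :: "'a::countable pmf"
  assumes "j \<noteq> k"
  shows "distr (iid_chain p) (count_space UNIV) (\<lambda>u. (u j, u k)) = measure_pmf (pair_pmf p p)"
proof (rule measure_eqI_countable[where A = UNIV])
  have [measurable]: "(\<lambda>u. u l) \<in> measurable (iid_chain p) (count_space UNIV)" for l
    by (simp add: measurable_cong_sets[OF sets_iid_chain refl])
  have m: "(\<lambda>u. (u j, u k)) \<in> measurable (iid_chain p) (count_space UNIV)"
    by (intro measurable_Pair_count_space) auto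
  fix w :: "'a \<times> 'a"
  obtain a b where w: "w = (a, b)" by (cases w)
  have "emeasure (distr (iid_chain p) (count_space UNIV) (\<lambda>u. (u j, u k))) {w} =
      emeasure (iid_chain p) ((\<lambda>u. (u j, u k)) -` {w})"
    by (subst emeasure_distr[OF m]) auto
  also have "(\<lambda>u. (u j, u k)) -` {w} = {u. \<forall>l\<in>{j, k}. u l \<in> (if l = j then {a} else {b})}"
    using assms by (auto simp: w)
  also have "emeasure (iid_chain p) \<dots> = emeasure (measure_pmf p) {a} * emeasure (measure_pmf p) {b}"
    using assms by (subst emeasure_iid_chain) auto
  also have "\<dots> = emeasure (measure_pmf (pair_pmf p p)) {w}"
    by (simp add: w emeasure_pmf_single pmf_pair ennreal_mult)
  finally show "emeasure (distr (iid_chain p) (count_space UNIV) (\<lambda>u. (u j, u k))) {w} =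
      emeasure (measure_pmf (pair_pmf p p)) {w}" .
qed auto

text \<open>Moving an almost sure statement along the image measure in \<open>osc_eq\<close>
  requires a measurable event; writing the count as a finite sum of coordinate indicators shows
  this.\<close>

lemma sets_limit_density:
  "{x \<in> space chain_space. (\<lambda>L. real (card {j \<in> {- int L..<int L}. x j = i}) / (2 * real L)) \<longlonglongrightarrow> r}
    \<in> sets chain_space"
proof -
  have [measurable]: "(\<lambda>x. x j) \<in> measurable chain_space (count_space UNIV)" for j
    unfolding chain_space_def by simp
  have *: "real (card {j \<in> {- int L..<int L}. x j = i}) = (\<Sum>j\<in>{- int L..<int L}. of_bool (x j = i))"
    for L and x :: "int \<Rightarrow> nat"
    by (subst sum_of_bool_eq) (auto simp: Int_def)
  show ?thesis unfolding * by measurable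
qed

text \<open>In the ordered model, \<open>u j\<close> is the displacement of the boundary between cells \<open>j - 1\<close> and \<open>j\<close>
  from its leftmost possible position \<open>2 ^ N * j\<close>.\<close>

definition offset_pmf :: "nat \<Rightarrow> nat pmf" where
  "offset_pmf N = pmf_of_set {..<2 ^ N}"

text \<open>Cell \<open>j\<close> lies between the boundaries \<open>2 ^ N * j + u j\<close> and
  \<open>2 ^ N * (j + 1) + u (j + 1)\<close>. Adding before subtracting keeps the natural
  subtraction exact when \<open>u j < 2 ^ N\<close>.\<close>

definition gaps :: "nat \<Rightarrow> (int \<Rightarrow> nat) \<Rightarrow> int \<Rightarrow> nat" where
  "gaps N u j = 2 ^ N + u (j + 1) - u j"

lemma set_pmf_offset_pmf: "set_pmf (offset_pmf N) = {..<2 ^ N}"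
  by (auto simp: offset_pmf_def lessThan_empty_iff)

text \<open>The coin chooses between the lower and the upper half of \<open>{..<2 ^ Suc N}\<close>,
  and the point is uniform within each half.\<close>

lemma offset_pmf_Suc:
  "bernoulli_pmf (1/2) \<bind> (\<lambda>s. map_pmf (if s then (\<lambda>a. a) else (\<lambda>a. 2 ^ N + a)) (offset_pmf N)) = offset_pmf (Suc N)"
proof (rule pmf_eqI)
  fix k :: nat
  have ne: "{..<2 ^ N} \<noteq> ({} :: nat set)" by (auto simp: lessThan_empty_iff)
  have "map_pmf (\<lambda>a. 2 ^ N + a) (offset_pmf N) = pmf_of_set ((\<lambda>a. 2 ^ N + a) ` {..<2 ^ N})"
    unfolding offset_pmf_def using ne by (intro map_pmf_of_set_inj) auto
  also have "(\<lambda>a. 2 ^ N + a) ` {..<2 ^ N} = {2 ^ N..<2 ^ Suc N :: nat}"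
    unfolding lessThan_atLeast0 by (simp add: image_add_atLeastLessThan mult_2)
  finally have *: "map_pmf (\<lambda>a. 2 ^ N + a) (offset_pmf N) = pmf_of_set {2 ^ N..<2 ^ Suc N}" .
  show "pmf (bernoulli_pmf (1/2) \<bind> (\<lambda>s. map_pmf (if s then (\<lambda>a. a) else (\<lambda>a. 2 ^ N + a)) (offset_pmf N))) k =
      pmf (offset_pmf (Suc N)) k"
    using ne by (simp add: pmf_bind *) (auto simp: offset_pmf_def lessThan_empty_iff indicator_def)
qed

lemma measurable_gaps: "gaps N \<in> measurable (Pi\<^sub>M UNIV (\<lambda>_. count_space UNIV)) chain_space"
  unfolding chain_space_def
proof (rule measurable_PiM_single')
  show "(\<lambda>u. gaps N u j) \<in> measurable (Pi\<^sub>M UNIV (\<lambda>_. count_space UNIV)) (count_space UNIV)" for j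
    unfolding gaps_def by measurable
qed auto

text \<open>The even cell \<open>2 * j\<close> lies between the old boundaries \<open>2 * j\<close>
  and \<open>2 * j + 1\<close>. If it moves right, the first survives as the left end of new cell
  \<open>j\<close>; otherwise the second does, which lies \<open>2 ^ N\<close> further along before
  its offset is added.\<close>

lemma merge_gaps:
  assumes "\<And>j. u j < 2 ^ N"
  shows "merge_cells (gaps N u) c = gaps (Suc N) (\<lambda>j. if c j then u (2 * j) else 2 ^ N + u (2 * j + 1))"
proof
  fix j :: int
  have *: "2 * (j + 1) = 2 * j + 2" "2 * j + 1 + 1 = 2 * j + 2" "2 * j + 2 + 1 = 2 * j + 3" by simp_all
  show "merge_cells (gaps N u) c j = gaps (Suc N) (\<lambda>j. if c j then u (2 * j) else 2 ^ N + u (2 * j + 1)) j"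
    using assms[of "2 * j"] assms[of "2 * j + 1"] assms[of "2 * j + 2"] assms[of "2 * j + 3"]
    unfolding merge_cells_def gaps_def * power_Suc by (cases "c j"; cases "c (j + 1)") simp_all
qed

text \<open>The weights of adjacent cells share a boundary, but the boundaries stay i.i.d.: merging
  acts on them as the selection in \<open>iid_chain_select\<close>.\<close>

lemma osc_eq: "osc N = distr (iid_chain (offset_pmf N)) chain_space (gaps N)"
proof (induction N)
  case 0
  interpret prob_space "iid_chain (return_pmf 0 :: nat pmf)" by (rule prob_space_iid_chain)
  have "offset_pmf 0 = return_pmf 0"
    by (simp add: offset_pmf_def lessThan_Suc pmf_of_set_singleton)
  moreover have "distr (iid_chain (return_pmf 0)) chain_space (gaps 0) =
      distr (iid_chain (return_pmf (0 :: nat))) chain_space (\<lambda>_ _. 1)"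
  proof (rule distr_cong_AE)
    have "AE u in iid_chain (return_pmf (0 :: nat)). \<forall>j. u j = 0"
      by (rule AE_iid_chain) auto
    then show "AE u in iid_chain (return_pmf 0). gaps 0 u = (\<lambda>_. 1)"
      by eventually_elim (simp add: gaps_def fun_eq_iff)
  qed (auto simp: measurable_cong_sets[OF sets_iid_chain refl] measurable_gaps[unfolded chain_space_def]
      chain_space_def space_PiM)
  ultimately show ?case
    by (simp add: osc_def unit_chain_def chain_space_def space_PiM)
next
  case (Suc N)
  let ?P = "iid_chain (offset_pmf N)"
  let ?V = "\<lambda>(u, c) j. if c j then u (2 * j) else 2 ^ N + u (2 * j + 1) :: nat"
  interpret P: prob_space ?P by (rule prob_space_iid_chain)
  interpret Q: prob_space fair_moves by (rule prob_space_fair_moves)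
  interpret PQ: pair_prob_space ?P fair_moves ..
  have g: "gaps N \<in> measurable ?P chain_space" for N
    by (simp add: measurable_cong_sets[OF sets_iid_chain refl] measurable_gaps)
  have V: "?V \<in> measurable (?P \<Otimes>\<^sub>M fair_moves) (Pi\<^sub>M UNIV (\<lambda>_. count_space UNIV))"
    by (rule measurable_iid_chain_select[where g = "\<lambda>a. a" and h = "\<lambda>a. 2 ^ N + a"])
  have mm: "(\<lambda>(x, c). merge_cells x c) \<in> measurable (chain_space \<Otimes>\<^sub>M fair_moves) chain_space"
    by (rule merge_cells_measurable) simp
  have gp: "(\<lambda>(u, c). (gaps N u, c)) \<in> measurable (?P \<Otimes>\<^sub>M fair_moves) (chain_space \<Otimes>\<^sub>M fair_moves)"
    using g by measurable
  have "osc (Suc N) = merge_law (distr ?P chain_space (gaps N))"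
    by (simp add: osc_def osc_step_def Suc[unfolded osc_def])
  \<comment> \<open>The moves are written as their own image under the identity, so that the product
    of two image measures becomes the image of a product.\<close>
  also have "\<dots> = distr (distr ?P chain_space (gaps N) \<Otimes>\<^sub>M distr fair_moves fair_moves (\<lambda>c. c)) chain_space
      (\<lambda>(x, c). merge_cells x c)"
    by (simp add: merge_law_def)
  also have "distr ?P chain_space (gaps N) \<Otimes>\<^sub>M distr fair_moves fair_moves (\<lambda>c. c) =
      distr (?P \<Otimes>\<^sub>M fair_moves) (chain_space \<Otimes>\<^sub>M fair_moves) (\<lambda>(u, c). (gaps N u, c))"
    by (rule pair_measure_distr) (auto simp: g intro: Q.sigma_finite_measure_axioms)
  also have "distr \<dots> chain_space (\<lambda>(x, c). merge_cells x c) =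
      distr (?P \<Otimes>\<^sub>M fair_moves) chain_space ((\<lambda>(x, c). merge_cells x c) \<circ> (\<lambda>(u, c). (gaps N u, c)))"
    by (rule distr_distr[OF mm gp])
  also have "\<dots> = distr (?P \<Otimes>\<^sub>M fair_moves) chain_space (gaps (Suc N) \<circ> ?V)"
  proof (rule distr_cong_AE)
    \<comment> \<open>\<open>merge_gaps\<close> needs every offset below \<open>2 ^ N\<close>, which
      holds only almost surely.\<close>
    have "AE u in ?P. \<forall>j. u j < 2 ^ N"
      by (rule AE_iid_chain) (simp add: set_pmf_offset_pmf)
    then have "AE u in distr (?P \<Otimes>\<^sub>M fair_moves) ?P fst. \<forall>j. u j < 2 ^ N"
      by (subst prob_space.distr_pair_fst[OF prob_space_fair_moves])
    then have "AE w in ?P \<Otimes>\<^sub>M fair_moves. \<forall>j. fst w j < 2 ^ N"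
      by (rule AE_distrD[OF measurable_fst])
    then show "AE w in ?P \<Otimes>\<^sub>M fair_moves. ((\<lambda>(x, c). merge_cells x c) \<circ> (\<lambda>(u, c). (gaps N u, c))) w = (gaps (Suc N) \<circ> ?V) w"
      by eventually_elim (auto simp: merge_gaps split: prod.splits)
  qed (auto intro!: measurable_comp[OF gp mm] measurable_comp[OF V measurable_gaps])
  also have "\<dots> = distr (distr (?P \<Otimes>\<^sub>M fair_moves) (Pi\<^sub>M UNIV (\<lambda>_. count_space UNIV)) ?V) chain_space (gaps (Suc N))"
    by (rule distr_distr[OF measurable_gaps V, symmetric])
  also have "distr (?P \<Otimes>\<^sub>M fair_moves) (Pi\<^sub>M UNIV (\<lambda>_. count_space UNIV)) ?V = iid_chain (offset_pmf (Suc N))"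
    using iid_chain_select[of "offset_pmf N" "\<lambda>a. a" "\<lambda>a. 2 ^ N + a"] by (simp only: offset_pmf_Suc)
  finally show ?case .
qed

lemma has_cell_density_osc:
  "has_cell_density (osc N) i
     (measure (measure_pmf (pair_pmf (offset_pmf N) (offset_pmf N))) {(a, b). 2 ^ N + b - a = i})"
    (is "has_cell_density _ _ ?r")
proof -
  let ?P = "iid_chain (offset_pmf N)"
  interpret prob_space ?P by (rule prob_space_iid_chain)
  have indep: "indep_vars (\<lambda>_. count_space UNIV) (\<lambda>j u. gaps N u j) {j. even j \<longleftrightarrow> e}" for e
  proof -
    \<comment> \<open>For \<open>j\<close> of one parity the blocks \<open>{j, j + 1}\<close> of
      boundaries are disjoint.\<close>
    have "indep_vars (\<lambda>j. Pi\<^sub>M {j, j + 1} (\<lambda>_. count_space UNIV))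
        (\<lambda>j u. restrict (\<lambda>k. u k) {j, j + 1}) {j. even j \<longleftrightarrow> e}"
      by (rule indep_vars_restrict[OF indep_vars_iid_chain])
         (auto simp: disjoint_family_on_def)
    from indep_vars_compose2[OF this, of "\<lambda>j v. 2 ^ N + v (j + 1) - v j" "\<lambda>_. count_space UNIV"]
    show ?thesis
      unfolding gaps_def by simp
  qed
  have "AE u in ?P. (\<lambda>L. real (card {j \<in> {- int L..<int L}. gaps N u j = i}) / (2 * real L)) \<longlonglongrightarrow> ?r"
  proof (rule AE_density_tendsto)
    show "indep_vars (\<lambda>_. count_space UNIV) (\<lambda>j u. gaps N u j) {j. even j}"
      "indep_vars (\<lambda>_. count_space UNIV) (\<lambda>j u. gaps N u j) {j. odd j}"
      using indep[of True] indep[of False] by simp_all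
    fix j :: int
    have m: "(\<lambda>u. (u j, u (j + 1))) \<in> measurable ?P (count_space UNIV)"
      by (intro measurable_Pair_count_space) (auto simp: measurable_cong_sets[OF sets_iid_chain refl])
    show "prob {u \<in> space ?P. gaps N u j = i} = ?r"
      unfolding distr_two_coords_iid_chain[of j "j + 1", simplified, symmetric]
      by (subst measure_distr[OF m]) (auto simp: gaps_def vimage_def)
  qed
  then show ?thesis
    unfolding has_cell_density_def osc_eq
    by (subst AE_distr_iff[OF _ sets_limit_density])
       (auto simp: measurable_cong_sets[OF sets_iid_chain refl] measurable_gaps)
qed

lemma cell_density_osc:
  assumes "1 \<le> i" "i \<le> 2 ^ N"
  shows "cell_density (osc N) i = real i / 4 ^ N"
proof -
  have "pair_pmf (offset_pmf N) (offset_pmf N) = pmf_of_set ({..<2 ^ N} \<times> {..<2 ^ N})"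
    unfolding offset_pmf_def by (intro pair_pmf_of_set) (auto simp: lessThan_empty_iff)
  then have "measure (measure_pmf (pair_pmf (offset_pmf N) (offset_pmf N))) {(a, b). 2 ^ N + b - a = i} =
      real (card (({..<2 ^ N} \<times> {..<2 ^ N}) \<inter> {(a, b). 2 ^ N + b - a = i})) / card ({..<2 ^ N :: nat} \<times> {..<2 ^ N :: nat})"
    by (simp add: measure_pmf_of_set lessThan_empty_iff)
  \<comment> \<open>Solving for \<open>a\<close> gives \<open>a = 2 ^ N + b - i\<close>, and
    \<open>a < 2 ^ N\<close> means \<open>b < i\<close>. Since \<open>i \<le> 2 ^ N\<close>, each
    such \<open>b\<close> is admissible, which leaves \<open>i\<close> pairs.\<close>
  also have "({..<2 ^ N} \<times> {..<2 ^ N}) \<inter> {(a, b). 2 ^ N + b - a = i} = (\<lambda>b. (2 ^ N + b - i, b)) ` {..<i}"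
    using assms by (auto simp: image_iff)
  also have "card \<dots> = i"
    by (subst card_image) (auto intro: inj_onI)
  also have "card ({..<2 ^ N :: nat} \<times> {..<2 ^ N :: nat}) = 4 ^ N"
    by (simp flip: power_mult_distrib)
  finally have "measure (measure_pmf (pair_pmf (offset_pmf N) (offset_pmf N))) {(a, b). 2 ^ N + b - a = i} = real i / 4 ^ N"
    by simp
  with has_cell_density_osc[of N i] show ?thesis
    using cell_density_eq[OF osc_prob(1)] by simp
qed

subsection \<open>Convergence of the scaled coefficients\<close>

text \<open>Subtracting the fixed point of the limiting map leaves a contraction with a vanishing
  perturbation.\<close>

lemma affine_recursion_tendsto:
  fixes x b :: "nat \<Rightarrow> real"
  assumes rec: "\<And>n. x (Suc n) = r * x n + b n" and r: "\<bar>r\<bar> < 1" and b: "b \<longlonglongrightarrow> \<beta>"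
  shows "x \<longlonglongrightarrow> \<beta> / (1 - r)"
proof -
  define y where "y n = x n - \<beta> / (1 - r)" for n
  define e where "e n = b n - \<beta>" for n
  have "e \<longlonglongrightarrow> 0"
    using tendsto_diff[OF b tendsto_const[of \<beta>]] by (simp add: e_def[abs_def])
  have y: "y (Suc n) = r * y n + e n" for n
    using r by (simp add: y_def e_def rec field_simps)
  have "y \<longlonglongrightarrow> 0"
  proof (rule LIMSEQ_I)
    fix \<epsilon> :: real assume "\<epsilon> > 0"
    define \<delta> where "\<delta> = \<epsilon> / 2"
    \<comment> \<open>Perturbations below \<open>\<delta> * (1 - \<bar>r\<bar>)\<close> accumulate
      to at most \<open>\<delta>\<close> along the geometric series; the other half of
      \<open>\<epsilon>\<close> is for the decaying initial error.\<close>
    have "\<delta> > 0" "\<delta> * (1 - \<bar>r\<bar>) > 0" using \<open>\<epsilon> > 0\<close> r by (simp_all add: \<delta>_def)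
    from LIMSEQ_D[OF \<open>e \<longlonglongrightarrow> 0\<close> this(2)] obtain n0
      where n0: "\<And>n. n \<ge> n0 \<Longrightarrow> \<bar>e n\<bar> < \<delta> * (1 - \<bar>r\<bar>)" by auto
    have bound: "\<bar>y (n0 + k)\<bar> \<le> \<bar>r\<bar> ^ k * \<bar>y n0\<bar> + \<delta>" for k
    proof (induction k)
      case 0
      then show ?case using \<open>\<delta> > 0\<close> by simp
    next
      case (Suc k)
      have "\<bar>y (n0 + Suc k)\<bar> \<le> \<bar>r\<bar> * \<bar>y (n0 + k)\<bar> + \<bar>e (n0 + k)\<bar>"
        using abs_triangle_ineq[of "r * y (n0 + k)" "e (n0 + k)"] by (simp add: y abs_mult)
      also have "\<dots> \<le> \<bar>r\<bar> * (\<bar>r\<bar> ^ k * \<bar>y n0\<bar> + \<delta>) + \<delta> * (1 - \<bar>r\<bar>)"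
        using n0[of "n0 + k"] by (intro add_mono mult_left_mono Suc) auto
      finally show ?case by (simp add: algebra_simps)
    qed
    have "(\<lambda>k. \<bar>r\<bar> ^ k * \<bar>y n0\<bar>) \<longlonglongrightarrow> 0 * \<bar>y n0\<bar>"
      using r by (intro tendsto_intros LIMSEQ_power_zero) auto
    then have "(\<lambda>k. \<bar>r\<bar> ^ k * \<bar>y n0\<bar>) \<longlonglongrightarrow> 0" by simp
    from LIMSEQ_D[OF this \<open>\<delta> > 0\<close>] obtain k0
      where k0: "\<And>k. k \<ge> k0 \<Longrightarrow> \<bar>r\<bar> ^ k * \<bar>y n0\<bar> < \<delta>" by (auto simp: abs_mult)
    show "\<exists>m. \<forall>n\<ge>m. norm (y n - 0) < \<epsilon>"
    proof (intro exI allI impI)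
      fix n assume "n \<ge> n0 + k0"
      then have "k0 \<le> n - n0" "n0 + (n - n0) = n" by simp_all
      with bound[of "n - n0"] k0[of "n - n0"] show "norm (y n - 0) < \<epsilon>"
        by (simp add: \<delta>_def)
    qed
  qed
  from tendsto_add[OF this tendsto_const[of "\<beta> / (1 - r)"]] show ?thesis
    by (simp add: y_def)
qed

text \<open>\<open>f ^ m\<close> starts at degree \<open>m\<close>, so coefficient \<open>n\<close>
  of \<open>F N oo f\<close> involves only coefficients \<open>m \<le> n\<close> of
  \<open>F N\<close>. Strong induction on \<open>n\<close> makes the lower ones a convergent
  inhomogeneity.\<close>

lemma weight_fps_recursion_tendsto_phi:
  fixes F :: "nat \<Rightarrow> real fps"
  assumes F0: "F 0 = fps_X" and FS: "\<And>N. F (Suc N) = F N * (fps_const (1/2) * (1 + F N)) ^ 2"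
  shows "(F N) $ 1 = (1/4) ^ N" and "i \<ge> 1 \<Longrightarrow> (\<lambda>N. 4 ^ N * F N $ i) \<longlonglongrightarrow> phi i"
proof -
  define f :: "real fps" where "f = fps_X * (fps_const (1/2) * (1 + fps_X)) ^ 2"
  have f0: "f $ 0 = 0" by (simp add: f_def)
  have F_0: "F N $ 0 = 0" for N by (induction N) (simp_all add: F0 FS)
  have f_oo: "f oo g = g * (fps_const (1/2) * (1 + g)) ^ 2" if "g $ 0 = 0" for g
    using that
    by (simp add: f_def fps_compose_mult_distrib fps_compose_power [symmetric] fps_compose_add_distrib)
  \<comment> \<open>Composing with \<open>f\<close> on the inside instead of the outside makes the recursion linear
      in the coefficients of \<open>F N\<close>.\<close>
  have comp: "F (Suc N) = F N oo f" for N
  proof (induction N)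
    case 0
    then show ?case by (simp add: F0 FS f0 f_def)
  next
    case (Suc N)
    have "F (Suc (Suc N)) = f oo F (Suc N)" by (simp add: f_oo F_0 FS[of "Suc N"])
    also have "\<dots> = (f oo F N) oo f" by (simp only: Suc fps_compose_assoc f0 F_0)
    also have "f oo F N = F (Suc N)" by (simp add: f_oo F_0 FS[of N])
    finally show ?case .
  qed
  \<comment> \<open>The factor \<open>(1 + fps_X) ^ (2 * m)\<close> is the source of the binomials
    in \<open>phi\<close>.\<close>
  have f_pow: "f ^ m = fps_const ((1/4) ^ m) * (fps_X ^ m * (1 + fps_X) ^ (2 * m))" for m
  proof -
    have "fps_const (1/2 :: real) ^ 2 = fps_const (1/4)"
      by (simp only: fps_const_power) (simp add: power2_eq_square)
    then have "f = fps_const (1/4) * (fps_X * (1 + fps_X) ^ 2)"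
      by (simp only: f_def power_mult_distrib mult_ac)
    then show ?thesis by (simp only: power_mult_distrib fps_const_power power_mult)
  qed
  have f_nth: "f ^ m $ n = (if n < m then 0 else (1/4) ^ m * real ((2 * m) choose (n - m)))" for m n
  proof -
    have "(1 + fps_X :: real fps) ^ (2 * m) $ k = real ((2 * m) choose k)" for k
      unfolding fps_binomial_of_nat [symmetric] fps_binomial_nth by (simp add: binomial_gbinomial)
    then show ?thesis by (simp add: f_pow fps_X_power_mult_nth)
  qed
  have rec: "4 ^ Suc N * F (Suc N) $ n =
      4 * (1/4) ^ n * (4 ^ N * F N $ n) + 4 * (\<Sum>m<n. (1/4) ^ m * real ((2 * m) choose (n - m)) * (4 ^ N * F N $ m))" for N n
  proof -
    have "F (Suc N) $ n = (\<Sum>m=0..n. F N $ m * (f ^ m $ n))"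
      by (simp add: comp fps_compose_nth)
    also have "{0..n} = insert n {..<n}" by auto
    also have "(\<Sum>m\<in>insert n {..<n}. F N $ m * (f ^ m $ n)) =
        (1/4) ^ n * F N $ n + (\<Sum>m<n. (1/4) ^ m * real ((2 * m) choose (n - m)) * F N $ m)"
      by (subst sum.insert) (auto simp: f_nth intro!: sum.cong)
    finally show ?thesis
      by (simp add: algebra_simps sum_distrib_left)
  qed
  show one: "(F N) $ 1 = (1/4) ^ N" for N
  proof (induction N)
    case (Suc N)
    have "F (Suc N) $ 1 = (1/4) * F N $ 1" using rec[of N 1] by (simp add: F_0)
    with Suc show ?case by simp
  qed (simp add: F0)
  show "(\<lambda>N. 4 ^ N * F N $ i) \<longlonglongrightarrow> phi i" if "i \<ge> 1" for i
    using that
  proof (induction i rule: less_induct)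
    case (less n)
    show ?case
    proof (cases "n = 1")
      case True
      then show ?thesis by (simp add: one[unfolded One_nat_def] power_one_over)
    next
      case False
      with less.prems obtain i where n: "n = Suc i" and i: "i \<ge> 1" by (cases n) auto
      let ?b = "\<lambda>N. 4 * (\<Sum>m<n. (1/4) ^ m * real ((2 * m) choose (n - m)) * (4 ^ N * F N $ m))"
      let ?\<beta> = "4 * (\<Sum>m<n. (1/4) ^ m * real ((2 * m) choose (n - m)) * phi m)"
      have "?b \<longlonglongrightarrow> ?\<beta>"
      proof (intro tendsto_intros)
        \<comment> \<open>At \<open>m = 0\<close> there is no induction hypothesis; both the
          coefficient and the dummy \<open>phi 0\<close> are zero.\<close>
        fix m assume "m \<in> {..<n}"
        then show "(\<lambda>N. 4 ^ N * F N $ m) \<longlonglongrightarrow> phi m"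
          using less.IH[of m] by (cases "m = 0") (auto simp: F_0)
      qed
      moreover have "\<bar>4 * (1/4) ^ n :: real\<bar> < 1"
        using i by (simp add: n power_less_one_iff)
      ultimately have "(\<lambda>N. 4 ^ N * F N $ n) \<longlonglongrightarrow> ?\<beta> / (1 - 4 * (1/4) ^ n)"
        using rec by (intro affine_recursion_tendsto[where b = ?b]) auto
      also have "?\<beta> / (1 - 4 * (1/4) ^ n) = phi n"
      proof -
        have "(\<Sum>m<n. (1/4) ^ m * real ((2 * m) choose (n - m)) * phi m) =
            (\<Sum>m=1..i. (1/4) ^ m * real ((2 * m) choose (n - m)) * phi m)"
          by (rule sum.mono_neutral_right) (auto simp: n Suc_le_eq)
        \<comment> \<open>The substitution is \<open>m = i - k\<close>; with
          \<open>n = Suc i\<close> it turns \<open>n - m\<close> into \<open>k + 1\<close>.\<close>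
        also have "\<dots> = (\<Sum>k=0..i - 1. (1/4) ^ (i - k) * real ((2 * (i - k)) choose (k + 1)) * phi (i - k))"
          by (rule sum.reindex_bij_witness[of _ "\<lambda>k. i - k" "\<lambda>m. i - m"]) (use i in \<open>auto simp: n Suc_diff_le\<close>)
        also have "\<dots> = (\<Sum>k=0..i - 1. 4 powi (int k - int i) * real ((2 * (i - k)) choose (k + 1)) * phi (i - k))"
        proof (rule sum.cong)
          fix k assume "k \<in> {0..i - 1}"
          then have "int k - int i = - int (i - k)" using i by auto
          then have "(4::real) powi (int k - int i) = (1/4) ^ (i - k)"
            by (simp only: power_int_minus power_int_of_nat power_one_over inverse_eq_divide)
          then show "(1/4) ^ (i - k) * real ((2 * (i - k)) choose (k + 1)) * phi (i - k) =
              4 powi (int k - int i) * real ((2 * (i - k)) choose (k + 1)) * phi (i - k)" by simp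
        qed simp
        finally have sum_eq: "(\<Sum>m<n. (1/4) ^ m * real ((2 * m) choose (n - m)) * phi m) = \<dots>" .
        have "(4::real) powi (- int i) = (1/4) ^ i"
          by (simp only: power_int_minus power_int_of_nat power_one_over inverse_eq_divide)
        then have pow: "(4::real) powi (- int i) = 4 * (1/4) ^ n"
          by (simp add: n)
        from i have "phi n = 4 / (1 - 4 powi (- int i)) *
            (\<Sum>k=0..i - 1. 4 powi (int k - int i) * real ((2 * (i - k)) choose (k + 1)) * phi (i - k))"
          unfolding n by (subst phi.simps(2)) simp
        then show ?thesis
          unfolding sum_eq pow by simp
      qed
      finally show ?thesis .
    qed
  qed
qed

subsection \<open>The disordered model\<close>

definition pmf_fps :: "nat pmf \<Rightarrow> real fps" where
  "pmf_fps p = Abs_fps (pmf p)"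

lemma pmf_fps_add:
  "pmf_fps (map_pmf (\<lambda>(a, b). a + b) (pair_pmf p q)) = pmf_fps p * pmf_fps q"
proof (rule fps_ext)
  fix n
  have "pmf (map_pmf (\<lambda>(a, b). a + b) (pair_pmf p q)) n =
      measure (measure_pmf (pair_pmf p q)) ((\<lambda>(a, b). a + b) -` {n})"
    by (simp add: pmf_map)
  also have "(\<lambda>(a, b). a + b) -` {n} = (\<lambda>a. (a, n - a)) ` {0..n}"
    by (auto simp: image_iff)
  also have "measure (measure_pmf (pair_pmf p q)) \<dots> = (\<Sum>w\<in>(\<lambda>a. (a, n - a)) ` {0..n}. pmf (pair_pmf p q) w)"
    by (rule measure_measure_pmf_finite) simp
  also have "\<dots> = (\<Sum>a=0..n. pmf p a * pmf q (n - a))"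
    by (subst sum.reindex) (auto simp: pmf_pair inj_on_def)
  finally show "pmf_fps (map_pmf (\<lambda>(a, b). a + b) (pair_pmf p q)) $ n = (pmf_fps p * pmf_fps q) $ n"
    by (simp add: pmf_fps_def fps_mult_nth)
qed

text \<open>Both orders occur: the left neighbour contributes when its coin is \<open>True\<close>,
  the right one when its coin is \<open>False\<close>.\<close>

lemma pmf_fps_fair_mixture:
  assumes "d True = return_pmf 0 \<and> d False = p \<or> d True = p \<and> d False = return_pmf 0"
  shows "pmf_fps (bernoulli_pmf (1/2) \<bind> d) = fps_const (1/2) * (1 + pmf_fps p)"
proof (rule fps_ext)
  fix n
  show "pmf_fps (bernoulli_pmf (1/2) \<bind> d) $ n = (fps_const (1/2) * (1 + pmf_fps p)) $ n"
    using assms by (auto simp: pmf_fps_def pmf_bind indicator_def add_divide_distrib)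
qed

text \<open>Each neighbour's coin is paired with its weight, so the two contributions are functions
  of independent pairs. The branches differ because \<open>True\<close> means a move to the
  right.\<close>

definition merged_pmf :: "nat pmf \<Rightarrow> nat pmf" where
  "merged_pmf p = map_pmf (\<lambda>(m, (c, a), (d, b)). m + ((if c then a else 0) + (if d then 0 else b)))
    (pair_pmf p (pair_pmf (pair_pmf (bernoulli_pmf (1/2)) p) (pair_pmf (bernoulli_pmf (1/2)) p)))"

text \<open>The cell's own weight and the two contributions are independent, so generating functions
  multiply; a neighbour contributes its weight or \<open>0\<close> with equal chance.\<close>

lemma pmf_fps_merged_pmf:
  "pmf_fps (merged_pmf p) = pmf_fps p * (fps_const (1/2) * (1 + pmf_fps p)) ^ 2"
proof -
  let ?B = "pair_pmf (bernoulli_pmf (1/2)) p"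
  let ?l = "\<lambda>(c, a). if c then a else 0 :: nat" and ?r = "\<lambda>(d, b). if d then 0 else b :: nat"
  have l: "map_pmf ?l ?B = bernoulli_pmf (1/2) \<bind> (\<lambda>c. if c then p else return_pmf 0)"
    unfolding pair_pmf_def map_bind_pmf map_return_pmf
    by (rule bind_pmf_cong) (auto simp: bind_return_pmf')
  have r: "map_pmf ?r ?B = bernoulli_pmf (1/2) \<bind> (\<lambda>c. if c then return_pmf 0 else p)"
    unfolding pair_pmf_def map_bind_pmf map_return_pmf
    by (rule bind_pmf_cong) (auto simp: bind_return_pmf')
  have "merged_pmf p = map_pmf (\<lambda>(a, b). a + b) (pair_pmf p
      (map_pmf (\<lambda>(a, b). a + b) (pair_pmf (map_pmf ?l ?B) (map_pmf ?r ?B))))"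
    unfolding merged_pmf_def pair_map_pmf1 pair_map_pmf2 map_pmf_comp
    by (rule map_pmf_cong) auto
  then have "pmf_fps (merged_pmf p) = pmf_fps p * (pmf_fps (map_pmf ?l ?B) * pmf_fps (map_pmf ?r ?B))"
    by (simp only: pmf_fps_add)
  also have "pmf_fps (map_pmf ?l ?B) = fps_const (1/2) * (1 + pmf_fps p)"
    unfolding l by (rule pmf_fps_fair_mixture) simp
  also have "pmf_fps (map_pmf ?r ?B) = fps_const (1/2) * (1 + pmf_fps p)"
    unfolding r by (rule pmf_fps_fair_mixture) simp
  finally show ?thesis by (simp only: power2_eq_square)
qed

text \<open>New cell \<open>0\<close> depends only on the old cells \<open>0\<close>,
  \<open>1\<close>, \<open>2\<close> and the coins \<open>0\<close>, \<open>1\<close>. Their joint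
  law lives on a countable type and can be compared point by point.\<close>

lemma distr_merge_law_iid_chain:
  "distr (merge_law (iid_chain p)) (count_space UNIV) (\<lambda>y. y 0) = measure_pmf (merged_pmf p)"
proof -
  let ?M = "iid_chain p \<Otimes>\<^sub>M fair_moves"
  let ?W = "\<lambda>(x :: int \<Rightarrow> nat, c :: int \<Rightarrow> bool). (x 1, (c 0, x 0), (c 1, x 2))"
  let ?q = "pair_pmf p (pair_pmf (pair_pmf (bernoulli_pmf (1/2)) p) (pair_pmf (bernoulli_pmf (1/2)) p))"
  let ?F = "\<lambda>(m, (c, a), (d, b)). m + ((if c then a else 0) + (if d then 0 else b)) :: nat"
  interpret Q: prob_space fair_moves by (rule prob_space_fair_moves)
  have x: "(\<lambda>w. fst w j) \<in> measurable ?M (count_space UNIV)" for j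
    by (rule measurable_compose[OF measurable_fst])
       (simp add: measurable_cong_sets[OF sets_iid_chain refl])
  have c: "(\<lambda>w. snd w j) \<in> measurable ?M (count_space UNIV)" for j
    by (rule measurable_compose[OF measurable_snd])
       (simp add: fair_moves_eq measurable_cong_sets[OF sets_iid_chain refl])
  have W: "?W \<in> measurable ?M (count_space UNIV)"
    unfolding case_prod_beta by (intro measurable_Pair_count_space x c)
  have mc: "(\<lambda>(x, c). merge_cells x c) \<in> measurable ?M chain_space"
    by (rule merge_cells_measurable[OF sets_iid_chain_nat])
  have y: "(\<lambda>y. y 0) \<in> measurable chain_space (count_space UNIV)"
    unfolding chain_space_def by simp
  have law: "distr ?M (count_space UNIV) ?W = measure_pmf ?q"
  proof (rule measure_eqI_countable[where A = UNIV])
    fix w :: "nat \<times> (bool \<times> nat) \<times> (bool \<times> nat)"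
    obtain m s a t b where w: "w = (m, (s, a), (t, b))" by (metis prod.exhaust)
    let ?A = "\<lambda>j::int. if j = 1 then {m} else if j = 0 then {a} else {b}"
    let ?C = "\<lambda>j::int. if j = 0 then {s} else {t}"
    have "emeasure (distr ?M (count_space UNIV) ?W) {w} = emeasure ?M (?W -` {w} \<inter> space ?M)"
      by (rule emeasure_distr[OF W]) simp
    also have "?W -` {w} \<inter> space ?M =
        {x. \<forall>j\<in>{0, 1, 2}. x j \<in> ?A j} \<times> {c. \<forall>j\<in>{0, 1}. c j \<in> ?C j}"
      by (auto simp: w space_pair_measure fair_moves_eq)
    also have "emeasure ?M \<dots> = emeasure (iid_chain p) {x. \<forall>j\<in>{0, 1, 2}. x j \<in> ?A j} *
        emeasure fair_moves {c. \<forall>j\<in>{0, 1}. c j \<in> ?C j}"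
    proof (rule Q.emeasure_pair_measure_Times)
      show "{x. \<forall>j\<in>{0, 1, 2}. x j \<in> ?A j} \<in> sets (iid_chain p)"
        "{c. \<forall>j\<in>{0, 1}. c j \<in> ?C j} \<in> sets fair_moves"
        unfolding fair_moves_eq by (rule sets_iid_chain_cylinder; simp)+
    qed
    also have "\<dots> = emeasure (measure_pmf ?q) {w}"
      unfolding fair_moves_eq
      by (subst (1 2) emeasure_iid_chain)
         (simp_all add: w emeasure_pmf_single pmf_pair mult_ac ennreal_mult del: pmf_bernoulli_half)
    finally show "emeasure (distr ?M (count_space UNIV) ?W) {w} = emeasure (measure_pmf ?q) {w}" .
  qed auto
  have "distr (merge_law (iid_chain p)) (count_space UNIV) (\<lambda>y. y 0) =
      distr ?M (count_space UNIV) ((\<lambda>y. y 0) \<circ> (\<lambda>(x, c). merge_cells x c))"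
    unfolding merge_law_def by (rule distr_distr[OF y mc])
  also have "(\<lambda>y. y 0) \<circ> (\<lambda>(x, c). merge_cells x c) = ?F \<circ> ?W"
    by (auto simp: fun_eq_iff merge_cells_def)
  also have "distr ?M (count_space UNIV) (?F \<circ> ?W) =
      distr (distr ?M (count_space UNIV) ?W) (count_space UNIV) ?F"
    by (rule distr_distr[OF _ W, symmetric]) simp
  also have "\<dots> = measure_pmf (merged_pmf p)"
    unfolding law merged_pmf_def by (rule map_pmf_rep_eq[symmetric])
  finally show ?thesis .
qed

text \<open>Reshuffling restores the i.i.d. form after each step, so only the one-cell law
  evolves.\<close>

lemma dsc_eq: "dsc N = iid_chain ((merged_pmf ^^ N) (return_pmf 1))"
proof (induction N)
  case 0
  show ?case
    by (simp add: dsc_def unit_chain_def iid_chain_return_pmf chain_space_def)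
next
  case (Suc N)
  have "dsc (Suc N) = dsc_step (dsc N)" by (simp add: dsc_def)
  then show ?case
    by (simp add: Suc dsc_step_def distr_merge_law_iid_chain) (simp add: iid_chain_def)
qed

lemma has_cell_density_iid_chain: "has_cell_density (iid_chain p) i (pmf p i)"
proof -
  interpret prob_space "iid_chain p" by (rule prob_space_iid_chain)
  have "prob {x \<in> space (iid_chain p). x j = i} = pmf p i" for j
  proof -
    have "prob {x \<in> space (iid_chain p). x j = i} = measure (distr (iid_chain p) (count_space UNIV) (\<lambda>x. x j)) {i}"
      by (subst measure_distr) (auto simp: measurable_cong_sets[OF sets_iid_chain refl] vimage_def)
    then show ?thesis by (simp add: distr_coord_iid_chain pmf.rep_eq)
  qed
  then show ?thesis
    unfolding has_cell_density_def
    by (intro AE_density_tendsto indep_vars_subset[OF indep_vars_iid_chain]) auto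
qed

lemma cell_density_dsc: "cell_density (dsc N) i = pmf ((merged_pmf ^^ N) (return_pmf 1)) i"
  using cell_density_eq[OF dsc_prob(1)] has_cell_density_iid_chain by (simp add: dsc_eq)

lemma cell_density_dsc_ratio_tendsto:
  assumes "i \<ge> 1"
  shows "(\<lambda>N. cell_density (dsc N) i / cell_density (dsc N) 1) \<longlonglongrightarrow> phi i"
proof -
  define F where "F N = pmf_fps ((merged_pmf ^^ N) (return_pmf 1))" for N
  have F0: "F 0 = fps_X"
    by (rule fps_ext) (auto simp: F_def pmf_fps_def fps_X_def indicator_def)
  have FS: "F (Suc N) = F N * (fps_const (1/2) * (1 + F N)) ^ 2" for N
    by (simp add: F_def pmf_fps_merged_pmf)
  have dens: "cell_density (dsc N) k = F N $ k" for N k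
    by (simp add: cell_density_dsc F_def pmf_fps_def)
  \<comment> \<open>The density of weight 1 is exactly \<open>(1/4) ^ N\<close>, so dividing by it
    is the scaling by \<open>4 ^ N\<close>.\<close>
  have "cell_density (dsc N) i / cell_density (dsc N) 1 = 4 ^ N * F N $ i" for N
    unfolding dens weight_fps_recursion_tendsto_phi(1)[OF F0 FS] by (simp add: power_one_over)
  with weight_fps_recursion_tendsto_phi(2)[OF F0 FS assms] show ?thesis by simp
qed

theorem corollary1p2:
  fixes i :: nat
  assumes "i \<ge> 1"
  shows "(\<forall>N. has_cell_density (osc N) i (cell_density (osc N) i))
      \<and> (\<forall>N. real N > log 2 (real i) \<longrightarrow>
            cell_density (osc N) i / cell_density (osc N) 1 = real i)
      \<and> (\<forall>N. has_cell_density (dsc N) i (cell_density (dsc N) i))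
      \<and> (\<lambda>N. cell_density (dsc N) i / cell_density (dsc N) 1) \<longlonglongrightarrow> phi i"
proof (intro conjI allI impI)
  show "has_cell_density (osc N) i (cell_density (osc N) i)" for N
    using has_cell_density_osc[of N i] cell_density_eq[OF osc_prob(1)] by simp
  show "cell_density (osc N) i / cell_density (osc N) 1 = real i" if "real N > log 2 (real i)" for N
  proof -
    have "real i < 2 powr real N"
      using that assms by (simp add: log_less_iff)
    then have "real i < real (2 ^ N)" by (simp add: powr_realpow)
    then have "i < 2 ^ N" by (simp only: of_nat_less_iff)
    \<comment> \<open>The formula is applied to weights \<open>i\<close> and \<open>1\<close>, and
      \<open>4 ^ N\<close> cancels.\<close>
    with assms show ?thesis by (simp add: cell_density_osc)
  qed
  show "has_cell_density (dsc N) i (cell_density (dsc N) i)" for N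
    by (simp only: cell_density_dsc) (simp only: dsc_eq has_cell_density_iid_chain)
  show "(\<lambda>N. cell_density (dsc N) i / cell_density (dsc N) 1) \<longlonglongrightarrow> phi i"
    using assms by (rule cell_density_dsc_ratio_tendsto)
qed

end
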